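(* Let $\mathbb{K}$ be a field, let $A$ be an associative $\mathbb{K}$-algebra (not assumed to be unital), and let $\alpha,\beta\in\mathbb{K}$. Let $\bar{R}:A\to A$ be a generalized Rota-Baxter operator of weights $(\alpha,\beta)$ on $A$, and let $\lambda,\mu\in \mathbb{K}$ be such that $$\alpha = \lambda+ \mu, \qquad \beta = \lambda\mu.$$ Set $$R = \bar{R} +\lambda\,\mathrm{id}, \qquad S = \bar{R} +\mu\,\mathrm{id}.$$ Then $(A,R,S)$ is a Rota-Baxter system.
   Context: Let $A$ be an associative algebra over a field $\mathbb{K}$, not assumed to be unital; $\mathrm{id}$ denotes the identity map on $A$. Generalized Rota-Baxter operator of weights $(\alpha,\beta)$, where $\alpha,\beta\in\mathbb{K}$: a $\mathbb{K}$-linear map $\bar{R}:A\to A$ such that, for all $a,b\in A$, $$\bar{R}(a)\bar{R}(b) = \bar{R}\left(\bar{R}(a) b + a \bar{R}(b) +\alpha\, ab\right) +\beta\, ab.$$ Rota-Baxter system: a triple $(A,R,S)$, where $R,S:A\to A$ are $\mathbb{K}$-linear operators such that, for all $a,b\in A$, $$R(a)R(b) = R\left(R(a) b + a S(b)\right), \qquad S(a)S(b) = S\left(R(a) b + a S(b)\right).$$ *)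

theory Defs
  imports Complex_Main
begin

(* The class ring is associative and does not assume a unit. *)
locale associative_algebra = vector_space scale
  for scale :: "'k::field \<Rightarrow> 'a::ring \<Rightarrow> 'a" +
  assumes mult_scale_left: "scale c a * b = scale c (a * b)"
    and mult_scale_right: "a * scale c b = scale c (a * b)"

locale generalized_rota_baxter_operator = associative_algebra scale
  for scale :: "'k::field \<Rightarrow> 'a::ring \<Rightarrow> 'a" +
  fixes \<alpha> \<beta> :: 'k
    and T :: "'a \<Rightarrow> 'a"
  assumes linear_T: "Vector_Spaces.linear scale scale T"
    and identity_T: "T a * T b = T (T a * b + a * T b + scale \<alpha> (a * b)) + scale \<beta> (a * b)"

locale rota_baxter_system = associative_algebra scale
  for scale :: "'k::field \<Rightarrow> 'a::ring \<Rightarrow> 'a" +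
  fixes R S :: "'a \<Rightarrow> 'a"
  assumes linear_R: "Vector_Spaces.linear scale scale R"
    and linear_S: "Vector_Spaces.linear scale scale S"
    and identity_R: "R a * R b = R (R a * b + a * S b)"
    and identity_S: "S a * S b = S (R a * b + a * S b)"

end

theory Submission
  imports Defs
begin

lemma (in vector_space) linear_add_scale:
  assumes "Vector_Spaces.linear scale scale f"
  shows "Vector_Spaces.linear scale scale (\<lambda>a. f a + scale c a)"
proof -
  interpret f: Vector_Spaces.linear scale scale f by fact
  show ?thesis
    by unfold_locales (simp_all add: f.add f.scale algebra_simps)
qed

text \<open>The shifts turning the generalized identity into a Rota-Baxter type identity are the
  roots \<open>c\<close> of \<open>x\<^sup>2 - \<alpha> x + \<beta>\<close>, here \<open>\<lambda>\<close> and \<open>\<mu>\<close>.\<close>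

lemma (in generalized_rota_baxter_operator) shift_identity:
  assumes root: "c * c + \<beta> = c * \<alpha>"
  defines "X \<equiv> \<lambda>a b. T a * b + a * T b + scale \<alpha> (a * b)"
  shows "(T a + scale c a) * (T b + scale c b) = T (X a b) + scale c (X a b)"
proof -
  have "(T a + scale c a) * (T b + scale c b)
      = T a * T b + scale c (T a * b + a * T b) + scale (c * c) (a * b)"
    by (simp add: algebra_simps mult_scale_left mult_scale_right)
  \<comment> \<open>\<open>identity_T\<close> replaces \<open>T a * T b\<close> by
    \<open>T (X a b)\<close> plus a \<beta>-multiple of \<open>a * b\<close>, which joins the
    quadratic term \<open>c * c\<close> from the two shifts.\<close>
  also have "\<dots> = T (X a b) + scale c (T a * b + a * T b) + scale (c * c + \<beta>) (a * b)"
    by (simp add: identity_T X_def algebra_simps)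
  \<comment> \<open>By \<open>root\<close> the last coefficient is \<open>c * \<alpha>\<close>,
    exactly what \<open>scale c\<close> of the third summand of \<open>X a b\<close>
    contributes.\<close>
  also have "\<dots> = T (X a b) + scale c (X a b)"
    unfolding root by (simp add: X_def algebra_simps)
  finally show ?thesis .
qed

theorem lemma1:
  fixes scale :: "'k::field \<Rightarrow> 'a::ring \<Rightarrow> 'a"
    and \<alpha> \<beta> l m :: 'k
    and Rbar R S :: "'a \<Rightarrow> 'a"
  assumes "associative_algebra scale"
    and "generalized_rota_baxter_operator scale \<alpha> \<beta> Rbar"
    and "\<alpha> = l + m"
    and "\<beta> = l * m"
    and "R = (\<lambda>a. Rbar a + scale l a)"
    and "S = (\<lambda>a. Rbar a + scale m a)"
  shows "rota_baxter_system scale R S"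
proof -
  interpret T: generalized_rota_baxter_operator scale \<alpha> \<beta> Rbar by fact
  \<comment> \<open>The shift in \<open>R a\<close> adds \<open>l\<close> copies of
    \<open>a * b\<close> and the one in \<open>S b\<close> adds \<open>m\<close>, in total \<alpha>.
    So both required identities have the same inner argument, the \<open>X a b\<close> of
    \<open>shift_identity\<close>.\<close>
  have X: "R a * b + a * S b = Rbar a * b + a * Rbar b + scale \<alpha> (a * b)" for a b
    using assms(3,5,6)
    by (simp add: algebra_simps T.mult_scale_left T.mult_scale_right)
  \<comment> \<open>Vieta: \<alpha> and \<beta> are the sum and product of \<open>l\<close> and
    \<open>m\<close>.\<close>
  have roots: "l * l + \<beta> = l * \<alpha>" "m * m + \<beta> = m * \<alpha>"
    using assms(3,4) by (simp_all add: algebra_simps)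
  show ?thesis
  proof (intro rota_baxter_system.intro rota_baxter_system_axioms.intro)
    show "associative_algebra scale" by fact
    show "Vector_Spaces.linear scale scale R" "Vector_Spaces.linear scale scale S"
      unfolding assms(5,6) by (intro T.linear_add_scale T.linear_T)+
    \<comment> \<open>Both identities are now \<open>shift_identity\<close>, at \<open>c = l\<close>
      for \<open>R\<close> and at \<open>c = m\<close> for \<open>S\<close>.\<close>
    show "R a * R b = R (R a * b + a * S b)" for a b
      unfolding X using T.shift_identity[OF roots(1)] by (simp add: assms(5))
    show "S a * S b = S (R a * b + a * S b)" for a b
      unfolding X using T.shift_identity[OF roots(2)] by (simp add: assms(6))
  qed
qed

end
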